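(* For every four-valued probability assignment $\hat p:\mathcal{L}\to\mathbb{R}^4$ there is a unique canonical model $\mathcal{M}_{\hat p}=\langle\mathcal{P}(\mathrm{Lit}),\mu,v^+,v^-\rangle$ whose induced four-valued probability function $\hat p_\mu$ satisfies $\hat p=\hat p_\mu$.
   Context: Let $\mathrm{Prop}$ be a fixed finite set of propositional variables, $\mathrm{Lit}=\mathrm{Prop}\cup\{\neg p\mid p\in\mathrm{Prop}\}$ the set of literals, and let $\mathcal{L}$ be the set of formulas generated by $\varphi::= p\mid\neg\varphi\mid\varphi\wedge\varphi$ with $p\in\mathrm{Prop}$; $\varphi\vee\psi$ abbreviates $\neg(\neg\varphi\wedge\neg\psi)$. Belnap-Dunn entailment: a double valuation is a pair of functions $v^+,v^-:\mathrm{Prop}\to\{0,1\}$ (arbitrary and independent of each other), extended to $\mathcal{L}$ by: $v^+(\neg\varphi)=1$ iff $v^-(\varphi)=1$; $v^-(\neg\varphi)=1$ iff $v^+(\varphi)=1$; $v^+(\varphi\wedge\psi)=1$ iff $v^+(\varphi)=1$ and $v^+(\psi)=1$; $v^-(\varphi\wedge\psi)=1$ iff $v^-(\varphi)=1$ or $v^-(\psi)=1$. Write $\varphi\vDash_L\psi$ iff for all double valuations, $v^+(\varphi)=1$ implies $v^+(\psi)=1$. A four-valued probability assignment is a function $\hat p:\mathcal{L}\to\mathbb{R}^4$ such that, writing $\hat p(\varphi)=(b_\varphi,d_\varphi,u_\varphi,c_\varphi)$, for all $\varphi,\psi\in\mathcal{L}$: (D1) $0\le b_\varphi,d_\varphi,u_\varphi,c_\varphi$;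 (D2) $b_\varphi+d_\varphi+u_\varphi+c_\varphi=1$; (D3) $b_{\neg\varphi}=d_\varphi$ and $c_{\neg\varphi}=c_\varphi$; (D4) if $\varphi\vDash_L\psi$ then $b_\varphi+c_\varphi\le b_\psi+c_\psi$; (D5) $b_{\varphi\wedge\neg\varphi}=0$ and $c_{\varphi\wedge\neg\varphi}=c_\varphi$; (D6) $b_\varphi+c_\varphi+b_\psi+c_\psi=b_{\varphi\wedge\psi}+c_{\varphi\wedge\psi}+b_{\varphi\vee\psi}+c_{\varphi\vee\psi}$. A probabilistic model is a tuple $\langle\Sigma,\mu,v^+,v^-\rangle$ where $\Sigma$ is a finite or countably infinite set, $v^+,v^-:\Sigma\times\mathrm{Prop}\to\{0,1\}$ are arbitrary functions, and $\mu$ is a (classical) probability measure on the full power set of $\Sigma$. Relations $\models^+,\models^-$ between states $s\in\Sigma$ and formulas: $s\models^+p$ iff $v^+(s,p)=1$; $s\models^-p$ iff $v^-(s,p)=1$; $s\models^+\varphi\wedge\psi$ iff $s\models^+\varphi$ and $s\models^+\psi$; $s\models^-\varphi\wedge\psi$ iff $s\models^-\varphi$ or $s\models^-\psi$; $s\models^+\neg\varphi$ iff $s\models^-\varphi$; $s\models^-\neg\varphi$ iff $s\models^+\varphi$. Put $|\varphi|^{\pm}=\{s: s\models^{\pm}\varphi\}$. The induced four-valued probability function is $\hat p_\mu(\varphi)=(\mu(|\varphi|^+\setminus|\varphi|^-),\ \mu(|\varphi|^-\setminus|\varphi|^+),\ \mu(\Sigma\setminus(|\varphi|^+\cup|\varphi|^-)),\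 \mu(|\varphi|^+\cap|\varphi|^-))$. A probabilistic model is canonical iff $\Sigma=\mathcal{P}(\mathrm{Lit})$ and, for all $q\in\mathrm{Prop}$ and $\sigma\subseteq\mathrm{Lit}$, $v^+(\sigma,q)=1$ iff $q\in\sigma$, and $v^-(\sigma,q)=1$ iff $\neg q\in\sigma$. (So canonical models differ only in $\mu$.) *)

theory Defs
  imports "HOL-Probability.Probability_Measure"
begin

text \<open>The finite set of propositional variables is a type \<open>'p\<close>, of class \<open>finite\<close> in the theorem.\<close>

datatype 'p form = Atom 'p | Neg "'p form" | Conj "'p form" "'p form"

definition Disj :: "'p form \<Rightarrow> 'p form \<Rightarrow> 'p form" where
  "Disj \<phi> \<psi> = Neg (Conj (Neg \<phi>) (Neg \<psi>))"

datatype 'p lit = Pos_lit 'p | Neg_lit 'p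

text \<open>The extension of a double valuation \<open>(v, w) = (v\<^sup>+, v\<^sup>-)\<close> to all formulas.\<close>

fun sat_pos :: "('p \<Rightarrow> bool) \<Rightarrow> ('p \<Rightarrow> bool) \<Rightarrow> 'p form \<Rightarrow> bool"
  and sat_neg :: "('p \<Rightarrow> bool) \<Rightarrow> ('p \<Rightarrow> bool) \<Rightarrow> 'p form \<Rightarrow> bool" where
  "sat_pos v w (Atom q) \<longleftrightarrow> v q"
| "sat_pos v w (Neg \<phi>) \<longleftrightarrow> sat_neg v w \<phi>"
| "sat_pos v w (Conj \<phi> \<psi>) \<longleftrightarrow> sat_pos v w \<phi> \<and> sat_pos v w \<psi>"
| "sat_neg v w (Atom q) \<longleftrightarrow> w q"
| "sat_neg v w (Neg \<phi>) \<longleftrightarrow> sat_pos v w \<phi>"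
| "sat_neg v w (Conj \<phi> \<psi>) \<longleftrightarrow> sat_neg v w \<phi> \<or> sat_neg v w \<psi>"

definition bd_entails :: "'p form \<Rightarrow> 'p form \<Rightarrow> bool" where
  "bd_entails \<phi> \<psi> \<longleftrightarrow> (\<forall>v w. sat_pos v w \<phi> \<longrightarrow> sat_pos v w \<psi>)"

text \<open>A quadruple lists belief, disbelief, uncertainty and conflict, in this order.\<close>

type_synonym quad = "real \<times> real \<times> real \<times> real"

definition bel :: "quad \<Rightarrow> real" where "bel x = fst x"
definition dis :: "quad \<Rightarrow> real" where "dis x = fst (snd x)"
definition unc :: "quad \<Rightarrow> real" where "unc x = fst (snd (snd x))"
definition con :: "quad \<Rightarrow> real" where "con x = snd (snd (snd x))"

definition four_valued_assignment :: "('p form \<Rightarrow> quad) \<Rightarrow> bool" where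
  "four_valued_assignment p \<longleftrightarrow>
     (\<forall>\<phi>. 0 \<le> bel (p \<phi>) \<and> 0 \<le> dis (p \<phi>) \<and> 0 \<le> unc (p \<phi>) \<and> 0 \<le> con (p \<phi>)) \<and>
     (\<forall>\<phi>. bel (p \<phi>) + dis (p \<phi>) + unc (p \<phi>) + con (p \<phi>) = 1) \<and>
     (\<forall>\<phi>. bel (p (Neg \<phi>)) = dis (p \<phi>) \<and> con (p (Neg \<phi>)) = con (p \<phi>)) \<and>
     (\<forall>\<phi> \<psi>. bd_entails \<phi> \<psi> \<longrightarrow>
        bel (p \<phi>) + con (p \<phi>) \<le> bel (p \<psi>) + con (p \<psi>)) \<and>
     (\<forall>\<phi>. bel (p (Conj \<phi> (Neg \<phi>))) = 0 \<and> con (p (Conj \<phi> (Neg \<phi>))) = con (p \<phi>)) \<and>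
     (\<forall>\<phi> \<psi>. bel (p \<phi>) + con (p \<phi>) + bel (p \<psi>) + con (p \<psi>) =
        bel (p (Conj \<phi> \<psi>)) + con (p (Conj \<phi> \<psi>)) +
        bel (p (Disj \<phi> \<psi>)) + con (p (Disj \<phi> \<psi>)))"

record ('s, 'p) model =
  states :: "'s set"
  prob_meas :: "'s measure"
  val_pos :: "'s \<Rightarrow> 'p \<Rightarrow> bool"
  val_neg :: "'s \<Rightarrow> 'p \<Rightarrow> bool"

definition prob_model :: "('s, 'p) model \<Rightarrow> bool" where
  "prob_model M \<longleftrightarrow>
     countable (states M) \<and>
     space (prob_meas M) = states M \<and>
     sets (prob_meas M) = Pow (states M) \<and>
     prob_space (prob_meas M)"

text \<open>The relations \<open>\<Turnstile>\<^sup>+\<close> and \<open>\<Turnstile>\<^sup>-\<close> at a state \<open>s\<close> obey the same clauses as a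
  double valuation, with the atoms evaluated at \<open>s\<close>.\<close>

definition ext_pos :: "('s, 'p) model \<Rightarrow> 'p form \<Rightarrow> 's set" where
  "ext_pos M \<phi> = {s \<in> states M. sat_pos (val_pos M s) (val_neg M s) \<phi>}"

definition ext_neg :: "('s, 'p) model \<Rightarrow> 'p form \<Rightarrow> 's set" where
  "ext_neg M \<phi> = {s \<in> states M. sat_neg (val_pos M s) (val_neg M s) \<phi>}"

definition induced :: "('s, 'p) model \<Rightarrow> 'p form \<Rightarrow> quad" where
  "induced M \<phi> =
     (measure (prob_meas M) (ext_pos M \<phi> - ext_neg M \<phi>),
      measure (prob_meas M) (ext_neg M \<phi> - ext_pos M \<phi>),
      measure (prob_meas M) (states M - (ext_pos M \<phi> \<union> ext_neg M \<phi>)),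
      measure (prob_meas M) (ext_pos M \<phi> \<inter> ext_neg M \<phi>))"

text \<open>All sets of literals are states, so the valuations of a canonical model are determined
  as total functions.\<close>

definition canonical :: "('p lit set, 'p) model \<Rightarrow> bool" where
  "canonical M \<longleftrightarrow>
     prob_model M \<and>
     states M = Pow UNIV \<and>
     (\<forall>\<sigma> q. val_pos M \<sigma> q \<longleftrightarrow> Pos_lit q \<in> \<sigma>) \<and>
     (\<forall>\<sigma> q. val_neg M \<sigma> q \<longleftrightarrow> Neg_lit q \<in> \<sigma>)"

end

theory Submission
  imports Defs
begin

text \<open>
  A four-valued assignment \<open>p\<close> is determined by the single number \<open>b + c\<close> of each formula, the mass
  of the states that support it: the conflict of \<open>\<phi>\<close> is the support of \<open>\<phi> \<and> \<not>\<phi>\<close>, its disbelief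
  is the belief of \<open>\<not>\<phi>\<close>, and uncertainty is what is missing to \<open>1\<close>. So a canonical model induces
  \<open>p\<close> iff its measure gives every truth set its support (\<open>induced_eq_iff_measure_truth\<close>).

  Truth sets over the sets of literals are up-closed, since negation exchanges the two valuations
  instead of complementing them.  They contain the set of all literals and miss the empty
  one, and every up-closed family with these two properties is a truth set
  (\<open>truth_onto_up_closed\<close>).  Entailment is inclusion of truth sets, so support becomes a monotone
  modular function on up-closed families, once it is extended by \<open>0\<close> on the empty family and by
  \<open>1\<close> on the whole space.

  On a finite order, a modular function on up-closed sets is the same as a weight on points
  (\<open>modular_eq_sum_point_weight\<close>): the weight of \<open>x\<close> must be the difference of the values at \<open>{x..}\<close>
  and at \<open>{x<..}\<close>, both of which are up-closed.  Monotonicity makes the weights nonnegative, which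
  gives existence.  Uniqueness is the same observation: the mass of a point is forced by the masses
  of these two up-closed sets.
\<close>

section \<open>Modular functions on the up-closed sets of a finite order\<close>

definition up_closed :: "'a::order set \<Rightarrow> bool" where
  "up_closed U \<longleftrightarrow> (\<forall>x\<in>U. {x..} \<subseteq> U)"

lemma up_closed_atLeast: "up_closed {x..}"
  unfolding up_closed_def by auto

lemma up_closed_greaterThan: "up_closed {x<..}"
  unfolding up_closed_def by auto

definition point_weight :: "('a::order set \<Rightarrow> real) \<Rightarrow> 'a \<Rightarrow> real" where
  "point_weight m x = m {x..} - m {x<..}"

text \<open>
  Removing a minimal point \<open>x\<close> from an up-closed set \<open>U\<close> leaves an up-closed set, and \<open>U\<close> is the
  union of that set with \<open>{x..}\<close>, while their intersection is \<open>{x<..}\<close>.  Modularity then says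
  that the removal costs exactly the weight of \<open>x\<close>.
\<close>

lemma modular_eq_sum_point_weight:
  fixes m :: "'a::{finite,order} set \<Rightarrow> real"
  assumes empty: "m {} = 0"
    and modular: "\<And>U V. up_closed U \<Longrightarrow> up_closed V \<Longrightarrow> m U + m V = m (U \<inter> V) + m (U \<union> V)"
    and "up_closed U"
  shows "m U = sum (point_weight m) U"
  using finite[of U] \<open>up_closed U\<close>
proof (induction U rule: finite_remove_induct)
  case empty
  show ?case by (simp add: assms(1))
next
  case (remove U)
  obtain x where x: "x \<in> U" and minimal: "\<And>y. y \<in> U \<Longrightarrow> y \<le> x \<Longrightarrow> x = y"
    using finite_has_minimal[OF finite remove(2)] by blast
  have up: "up_closed (U - {x})"
    using remove.prems minimal unfolding up_closed_def by fastforce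
  have "{x..} \<subseteq> U"
    using x remove.prems unfolding up_closed_def by blast
  then have int: "{x..} \<inter> (U - {x}) = {x<..}" and un: "{x..} \<union> (U - {x}) = U"
    using x by (auto simp: subset_iff)
  have "m U = point_weight m x + m (U - {x})"
    using modular[OF up_closed_atLeast up, of x] by (simp add: int un point_weight_def)
  also have "\<dots> = point_weight m x + sum (point_weight m) (U - {x})"
    using remove.IH[OF x up] by simp
  also have "\<dots> = sum (point_weight m) U"
    using x by (simp add: sum.remove)
  finally show ?case .
qed

section \<open>Truth sets are the nontrivial up-closed families of sets of literals\<close>

definition truth :: "'p form \<Rightarrow> 'p lit set set" where
  "truth \<phi> = {\<sigma>. sat_pos (\<lambda>q. Pos_lit q \<in> \<sigma>) (\<lambda>q. Neg_lit q \<in> \<sigma>) \<phi>}"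

lemma truth_Conj: "truth (Conj \<phi> \<psi>) = truth \<phi> \<inter> truth \<psi>"
  unfolding truth_def by auto

lemma truth_Disj: "truth (Disj \<phi> \<psi>) = truth \<phi> \<union> truth \<psi>"
  unfolding truth_def Disj_def by auto

text \<open>A set of literals is the same thing as a double valuation.\<close>

lemma bd_entails_iff_truth_subset:
  fixes \<phi> \<psi> :: "'a form"
  shows "bd_entails \<phi> \<psi> \<longleftrightarrow> truth \<phi> \<subseteq> truth \<psi>"
proof
  assume sub: "truth \<phi> \<subseteq> truth \<psi>"
  show "bd_entails \<phi> \<psi>"
    unfolding bd_entails_def
  proof (intro allI)
    fix v w :: "'a \<Rightarrow> bool"
    define \<sigma> where "\<sigma> = Pos_lit ` {q. v q} \<union> Neg_lit ` {q. w q}"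
    have "(\<lambda>q. Pos_lit q \<in> \<sigma>) = v" "(\<lambda>q. Neg_lit q \<in> \<sigma>) = w"
      by (auto simp: \<sigma>_def)
    then show "sat_pos v w \<phi> \<longrightarrow> sat_pos v w \<psi>"
      using sub unfolding truth_def by (auto dest: subsetD[where c = \<sigma>])
  qed
qed (auto simp: bd_entails_def truth_def)

text \<open>
  The two relations have to be treated together, because negation turns each into the other.
\<close>

lemma sat_mono:
  assumes "v \<le> v'" "w \<le> w'"
  shows "(sat_pos v w \<phi> \<longrightarrow> sat_pos v' w' \<phi>) \<and> (sat_neg v w \<phi> \<longrightarrow> sat_neg v' w' \<phi>)"
  using assms by (induction \<phi>) auto

lemma up_closed_truth: "up_closed (truth \<phi>)"
proof -
  have "\<tau> \<in> truth \<phi>" if "\<sigma> \<in> truth \<phi>" "\<sigma> \<subseteq> \<tau>" for \<sigma> \<tau>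
    using that sat_mono[of "\<lambda>q. Pos_lit q \<in> \<sigma>" "\<lambda>q. Pos_lit q \<in> \<tau>"
        "\<lambda>q. Neg_lit q \<in> \<sigma>" "\<lambda>q. Neg_lit q \<in> \<tau>" \<phi>]
    by (auto simp: truth_def)
  then show ?thesis unfolding up_closed_def by auto
qed

lemma UNIV_in_truth: "UNIV \<in> truth \<phi>"
proof -
  have "sat_pos (\<lambda>q. True) (\<lambda>q. True) \<phi> \<and> sat_neg (\<lambda>q. True) (\<lambda>q. True) \<phi>"
    by (induction \<phi>) auto
  then show ?thesis by (simp add: truth_def)
qed

lemma empty_notin_truth: "{} \<notin> truth \<phi>"
proof -
  have "\<not> sat_pos (\<lambda>q. False) (\<lambda>q. False) \<phi> \<and> \<not> sat_neg (\<lambda>q. False) (\<lambda>q. False) \<phi>"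
    by (induction \<phi>) auto
  then show ?thesis by (simp add: truth_def)
qed

lemma truth_nontrivial: "truth \<phi> \<noteq> {}" "truth \<phi> \<noteq> UNIV"
  using UNIV_in_truth empty_notin_truth by blast+

lemma up_closed_nontrivial:
  fixes U :: "'a set set"
  assumes "up_closed U" "U \<noteq> {}" "U \<noteq> UNIV"
  shows "UNIV \<in> U" "{} \<notin> U"
proof -
  have up: "\<tau> \<in> U" if "\<sigma> \<in> U" "\<sigma> \<subseteq> \<tau>" for \<sigma> \<tau>
    using assms(1) that unfolding up_closed_def by auto
  show "UNIV \<in> U"
    using assms(2) up[OF _ subset_UNIV] by auto
  show "{} \<notin> U"
    using assms(3) up[OF _ empty_subsetI] by auto
qed

instance lit :: (finite) finite
proof
  have "l \<in> range Pos_lit \<union> range Neg_lit" for l :: "'a lit"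
    by (cases l) auto
  then have "(UNIV :: 'a lit set) \<subseteq> range Pos_lit \<union> range Neg_lit" by blast
  moreover have "finite (range (Pos_lit :: 'a \<Rightarrow> 'a lit) \<union> range Neg_lit)" by simp
  ultimately show "finite (UNIV :: 'a lit set)" by (rule finite_subset)
qed

lemma truth_literal: "\<exists>\<phi>. truth \<phi> = {\<tau>. l \<in> \<tau>}"
proof (cases l)
  case (Pos_lit q)
  then have "truth (Atom q) = {\<tau>. l \<in> \<tau>}" by (simp add: truth_def)
  then show ?thesis ..
next
  case (Neg_lit q)
  then have "truth (Neg (Atom q)) = {\<tau>. l \<in> \<tau>}" by (simp add: truth_def)
  then show ?thesis ..
qed

text \<open>
  The empty set of literals has to be excluded, as it would call for an empty conjunction, which is
  not a formula.
\<close>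

lemma truth_atLeast:
  assumes "finite \<sigma>" "\<sigma> \<noteq> {}"
  shows "\<exists>\<phi>. truth \<phi> = {\<sigma>..}"
  using assms
proof (induction \<sigma> rule: finite_ne_induct)
  case (singleton l)
  then show ?case using truth_literal[of l] by (simp add: atLeast_def)
next
  case (insert l \<sigma>)
  obtain \<phi> \<psi> where "truth \<phi> = {\<tau>. l \<in> \<tau>}" "truth \<psi> = {\<sigma>..}"
    using truth_literal insert.IH by metis
  then have "truth (Conj \<phi> \<psi>) = {insert l \<sigma>..}"
    by (auto simp: truth_Conj)
  then show ?case ..
qed

lemma truth_UN_atLeast:
  fixes S :: "'p::finite lit set set"
  assumes "finite S" "S \<noteq> {}" "{} \<notin> S"
  shows "\<exists>\<phi>. truth \<phi> = (\<Union>\<sigma>\<in>S. {\<sigma>..})"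
  using assms
proof (induction S rule: finite_ne_induct)
  case (singleton \<sigma>)
  then show ?case using truth_atLeast[OF finite, of \<sigma>] by auto
next
  case (insert \<sigma> S)
  then obtain \<phi> \<psi> where "truth \<phi> = {\<sigma>..}" "truth \<psi> = (\<Union>\<sigma>\<in>S. {\<sigma>..})"
    using truth_atLeast[OF finite, of \<sigma>] by auto
  then have "truth (Disj \<phi> \<psi>) = (\<Union>\<sigma>\<in>insert \<sigma> S. {\<sigma>..})"
    by (simp add: truth_Disj)
  then show ?case ..
qed

text \<open>
  An up-closed family is the union of the cones \<open>{\<sigma>..}\<close> over its members \<open>\<sigma>\<close>, which gives a formula
  in disjunctive normal form.
\<close>

lemma truth_onto_up_closed:
  fixes U :: "'p::finite lit set set"
  assumes "up_closed U" "U \<noteq> {}" "U \<noteq> UNIV"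
  shows "\<exists>\<phi>. truth \<phi> = U"
proof -
  have "(\<Union>\<sigma>\<in>U. {\<sigma>..}) = U"
    using assms(1) unfolding up_closed_def by auto
  then show ?thesis
    using truth_UN_atLeast[OF finite assms(2) up_closed_nontrivial(2)[OF assms]] by simp
qed

section \<open>Support as a modular function on up-closed families\<close>

definition support :: "('p form \<Rightarrow> quad) \<Rightarrow> 'p form \<Rightarrow> real" where
  "support p \<phi> = bel (p \<phi>) + con (p \<phi>)"

lemma support_bounds:
  assumes "four_valued_assignment p"
  shows "0 \<le> support p \<phi>" "support p \<phi> \<le> 1"
proof -
  have "0 \<le> bel (p \<phi>)" "0 \<le> dis (p \<phi>)" "0 \<le> unc (p \<phi>)" "0 \<le> con (p \<phi>)"
    "bel (p \<phi>) + dis (p \<phi>) + unc (p \<phi>) + con (p \<phi>) = 1"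
    using assms unfolding four_valued_assignment_def by blast+
  then show "0 \<le> support p \<phi>" "support p \<phi> \<le> 1"
    unfolding support_def by linarith+
qed

lemma support_mono:
  assumes "four_valued_assignment p" "truth \<phi> \<subseteq> truth \<psi>"
  shows "support p \<phi> \<le> support p \<psi>"
  using assms unfolding four_valued_assignment_def support_def
  by (simp add: bd_entails_iff_truth_subset)

lemma support_modular:
  assumes "four_valued_assignment p"
  shows "support p \<phi> + support p \<psi> = support p (Conj \<phi> \<psi>) + support p (Disj \<phi> \<psi>)"
proof -
  have "bel (p \<phi>) + con (p \<phi>) + bel (p \<psi>) + con (p \<psi>) =
      bel (p (Conj \<phi> \<psi>)) + con (p (Conj \<phi> \<psi>)) + bel (p (Disj \<phi> \<psi>)) + con (p (Disj \<phi> \<psi>))"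
    using assms unfolding four_valued_assignment_def by blast
  then show ?thesis unfolding support_def by linarith
qed

text \<open>The two trivial families are not truth sets and get the values that a probability must have.\<close>

definition up_support :: "('p form \<Rightarrow> quad) \<Rightarrow> 'p lit set set \<Rightarrow> real" where
  "up_support p U =
     (if U = {} then 0 else if U = UNIV then 1 else support p (SOME \<phi>. truth \<phi> = U))"

text \<open>The choice of a formula is harmless, because formulas with equal truth sets entail each other.\<close>

lemma up_support_truth:
  assumes "four_valued_assignment p"
  shows "up_support p (truth \<phi>) = support p \<phi>"
proof -
  have "truth (SOME \<psi>. truth \<psi> = truth \<phi>) = truth \<phi>"
    by (rule someI[of _ \<phi>]) simp
  then have "support p (SOME \<psi>. truth \<psi> = truth \<phi>) = support p \<phi>"
    using support_mono[OF assms] by (metis order.antisym order.refl)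
  then show ?thesis by (simp add: up_support_def truth_nontrivial)
qed

lemma up_support_mono:
  fixes p :: "'p::finite form \<Rightarrow> quad"
  assumes p: "four_valued_assignment p" and up: "up_closed U" "up_closed V" and "U \<subseteq> V"
  shows "up_support p U \<le> up_support p V"
proof -
  have bounds: "0 \<le> up_support p W" "up_support p W \<le> 1" for W
    using support_bounds[OF p] by (auto simp: up_support_def)
  consider "U = {}" | "V = UNIV" | "U \<noteq> {}" "U \<noteq> UNIV" "V \<noteq> {}" "V \<noteq> UNIV"
    using \<open>U \<subseteq> V\<close> by blast
  then show ?thesis
  proof cases
    case 3
    then obtain \<phi> \<psi> where "truth \<phi> = U" "truth \<psi> = V"
      using truth_onto_up_closed up by metis
    then show ?thesis
      using support_mono[OF p] up_support_truth[OF p] \<open>U \<subseteq> V\<close> by metis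
  qed (use bounds in \<open>auto simp: up_support_def\<close>)
qed

lemma up_support_modular:
  fixes p :: "'p::finite form \<Rightarrow> quad"
  assumes p: "four_valued_assignment p" and up: "up_closed U" "up_closed V"
  shows "up_support p U + up_support p V = up_support p (U \<inter> V) + up_support p (U \<union> V)"
proof -
  consider "U = {}" | "U = UNIV" | "V = {}" | "V = UNIV"
    | "U \<noteq> {}" "U \<noteq> UNIV" "V \<noteq> {}" "V \<noteq> UNIV"
    by blast
  then show ?thesis
  proof cases
    case 5
    then obtain \<phi> \<psi> where "truth \<phi> = U" "truth \<psi> = V"
      using truth_onto_up_closed up by metis
    then show ?thesis
      using support_modular[OF p] up_support_truth[OF p] truth_Conj truth_Disj by metis
  qed auto
qed

section \<open>Canonical models and their measures\<close>

lemma canonical_space: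
  assumes "canonical M"
  shows "space (prob_meas M) = UNIV" "sets (prob_meas M) = UNIV" "prob_space (prob_meas M)"
  using assms unfolding canonical_def prob_model_def by auto

lemma canonical_ext:
  assumes "canonical M"
  shows "ext_pos M \<phi> = truth \<phi>" "ext_neg M \<phi> = truth (Neg \<phi>)"
proof -
  have "val_pos M = (\<lambda>\<sigma> q. Pos_lit q \<in> \<sigma>)" "val_neg M = (\<lambda>\<sigma> q. Neg_lit q \<in> \<sigma>)"
    "states M = UNIV"
    using assms unfolding canonical_def by (auto simp: fun_eq_iff)
  then show "ext_pos M \<phi> = truth \<phi>" "ext_neg M \<phi> = truth (Neg \<phi>)"
    by (simp_all add: ext_pos_def ext_neg_def truth_def)
qed

text \<open>
  The four components of \<open>induced M \<phi>\<close> are determined by the masses of the truth sets of \<open>\<phi>\<close>,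
  \<open>\<not>\<phi>\<close> and \<open>\<phi> \<and> \<not>\<phi>\<close>.  The assignment \<open>p\<close> is determined in the same way by the supports
  of these formulas, which are \<open>b + c\<close>, \<open>d + c\<close> and \<open>c\<close>.
\<close>

lemma induced_eq_iff_measure_truth:
  assumes M: "canonical M" and p: "four_valued_assignment p"
  shows "induced M = p \<longleftrightarrow> (\<forall>\<phi>. measure (prob_meas M) (truth \<phi>) = support p \<phi>)"
proof -
  interpret prob_space "prob_meas M" by (rule canonical_space(3)[OF M])
  note sets = canonical_space(2)[OF M]
  have diff: "prob (A - B) = prob A - prob (A \<inter> B)" for A B
    by (rule finite_measure_Diff') (simp_all add: sets)
  have union: "prob (A \<union> B) = prob A + prob B - prob (A \<inter> B)" for A B
    using finite_measure_Union'[of A B] diff[of B A] by (simp add: sets Int_commute)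
  have total: "prob UNIV = 1"
    using prob_space by (simp add: canonical_space(1)[OF M])
  have states: "states M = UNIV"
    using M unfolding canonical_def by simp
  have induced: "induced M \<phi> =
      (let t = prob (truth \<phi>); f = prob (truth (Neg \<phi>)); c = prob (truth (Conj \<phi> (Neg \<phi>)))
       in (t - c, f - c, 1 - (t + f - c), c))" for \<phi>
    unfolding induced_def Let_def states
    by (simp add: canonical_ext[OF M] diff union total truth_Conj Int_commute)
  show ?thesis
  proof
    assume eq: "induced M = p"
    have "support p \<phi> = prob (truth \<phi>)" for \<phi>
      using induced[of \<phi>] eq by (simp add: support_def bel_def con_def Let_def)
    then show "\<forall>\<phi>. prob (truth \<phi>) = support p \<phi>" by simp
  next
    assume meas: "\<forall>\<phi>. prob (truth \<phi>) = support p \<phi>"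
    have "induced M \<phi> = p \<phi>" for \<phi>
    proof -
      have neg: "bel (p (Neg \<phi>)) = dis (p \<phi>)" "con (p (Neg \<phi>)) = con (p \<phi>)"
        and conj: "bel (p (Conj \<phi> (Neg \<phi>))) = 0" "con (p (Conj \<phi> (Neg \<phi>))) = con (p \<phi>)"
        and sum: "bel (p \<phi>) + dis (p \<phi>) + unc (p \<phi>) + con (p \<phi>) = 1"
        using p unfolding four_valued_assignment_def by blast+
      have "induced M \<phi> = (bel (p \<phi>), dis (p \<phi>), unc (p \<phi>), con (p \<phi>))"
        using meas sum by (simp add: induced Let_def support_def neg conj)
      then show ?thesis by (simp add: bel_def dis_def unc_def con_def)
    qed
    then show "induced M = p" ..
  qed
qed

text \<open>
  Every up-closed family is a truth set or trivial, so probabilities that agree on truth sets agree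
  on all cones \<open>{\<sigma>..}\<close> and \<open>{\<sigma><..}\<close>, hence on the singletons, which are their differences.
\<close>

lemma canonical_eqI:
  fixes M N :: "('p::finite lit set, 'p) model"
  assumes M: "canonical M" and N: "canonical N"
    and eq: "\<And>\<phi>. measure (prob_meas M) (truth \<phi>) = measure (prob_meas N) (truth \<phi>)"
  shows "M = N"
proof -
  interpret M: prob_space "prob_meas M" by (rule canonical_space(3)[OF M])
  interpret N: prob_space "prob_meas N" by (rule canonical_space(3)[OF N])
  have up: "M.prob U = N.prob U" if "up_closed U" for U
  proof (cases "U = {} \<or> U = UNIV")
    case True
    then show ?thesis
      using M.prob_space N.prob_space canonical_space(1)[OF M] canonical_space(1)[OF N] by auto
  next
    case False
    then show ?thesis using truth_onto_up_closed[OF that] eq by metis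
  qed
  have point: "M.prob {\<sigma>} = N.prob {\<sigma>}" for \<sigma>
  proof -
    have "{\<sigma>} = {\<sigma>..} - {\<sigma><..}" "{\<sigma><..} \<subseteq> {\<sigma>..}" by auto
    then have "M.prob {\<sigma>} = M.prob {\<sigma>..} - M.prob {\<sigma><..}"
      "N.prob {\<sigma>} = N.prob {\<sigma>..} - N.prob {\<sigma><..}"
      using M.finite_measure_Diff[of "{\<sigma>..}" "{\<sigma><..}"]
        N.finite_measure_Diff[of "{\<sigma>..}" "{\<sigma><..}"]
      by (simp_all add: canonical_space(2)[OF M] canonical_space(2)[OF N])
    then show ?thesis by (simp add: up up_closed_atLeast up_closed_greaterThan)
  qed
  have "prob_meas M = prob_meas N"
  proof (rule measure_eqI_finite[of _ UNIV])
    show "sets (prob_meas M) = Pow UNIV" "sets (prob_meas N) = Pow UNIV"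
      using canonical_space(2) M N by auto
  qed (simp_all add: point M.emeasure_eq_measure N.emeasure_eq_measure)
  moreover have "states M = states N" "val_pos M = val_pos N" "val_neg M = val_neg N"
    using M N unfolding canonical_def by (auto simp: fun_eq_iff)
  ultimately show ?thesis by simp
qed

definition canonical_model :: "('p lit set \<Rightarrow> real) \<Rightarrow> ('p lit set, 'p) model" where
  "canonical_model w =
     \<lparr>states = UNIV, prob_meas = point_measure UNIV (\<lambda>\<sigma>. ennreal (w \<sigma>)),
      val_pos = (\<lambda>\<sigma> q. Pos_lit q \<in> \<sigma>), val_neg = (\<lambda>\<sigma> q. Neg_lit q \<in> \<sigma>)\<rparr>"

lemma canonical_model:
  fixes w :: "'p::finite lit set \<Rightarrow> real"
  assumes nonneg: "\<And>\<sigma>. 0 \<le> w \<sigma>" and total: "sum w UNIV = 1"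
  shows "canonical (canonical_model w)"
    and "measure (prob_meas (canonical_model w)) A = sum w A"
proof -
  have em: "emeasure (point_measure UNIV (\<lambda>\<sigma>. ennreal (w \<sigma>))) A = ennreal (sum w A)" for A
    using nonneg by (simp add: emeasure_point_measure_finite sum_ennreal)
  then show "measure (prob_meas (canonical_model w)) A = sum w A"
    using nonneg by (simp add: canonical_model_def measure_def sum_nonneg)
  have "prob_space (point_measure UNIV (\<lambda>\<sigma>. ennreal (w \<sigma>)))"
    by (rule prob_spaceI) (simp add: em total space_point_measure)
  then show "canonical (canonical_model w)"
    unfolding canonical_def prob_model_def canonical_model_def
    by (simp add: space_point_measure sets_point_measure countable_finite)
qed

theorem theorem5:
  fixes p :: "'p::finite form \<Rightarrow> quad"
  assumes "four_valued_assignment p"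
  shows "\<exists>!M. canonical M \<and> induced M = p"
proof (rule ex_ex1I)
  let ?w = "point_weight (up_support p)"
  have empty: "up_support p {} = 0" by (simp add: up_support_def)
  have sum: "sum ?w U = up_support p U" if "up_closed U" for U
    using modular_eq_sum_point_weight[OF empty up_support_modular[OF assms] that] by simp
  have "{\<sigma><..} \<subseteq> {\<sigma>..}" for \<sigma> :: "'p lit set" by auto
  then have "0 \<le> ?w \<sigma>" for \<sigma>
    unfolding point_weight_def
    using up_support_mono[OF assms up_closed_greaterThan up_closed_atLeast] by simp
  moreover have "sum ?w UNIV = 1"
    using sum[of UNIV] by (simp add: up_closed_def up_support_def)
  ultimately have can: "canonical (canonical_model ?w)"
    and meas: "measure (prob_meas (canonical_model ?w)) A = sum ?w A" for A
    by (rule canonical_model)+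
  have "induced (canonical_model ?w) = p"
    unfolding induced_eq_iff_measure_truth[OF can assms] meas
    by (simp add: sum up_closed_truth up_support_truth[OF assms])
  with can show "\<exists>M. canonical M \<and> induced M = p" by blast
next
  fix M N assume "canonical M \<and> induced M = p" "canonical N \<and> induced N = p"
  then show "M = N"
    using canonical_eqI induced_eq_iff_measure_truth[OF _ assms] by metis
qed

end
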